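(* Let $D$ be a real composition division algebra of dimension $d\in\{2,4,8\}$, let $E_D\to\mathbb{RP}^d$ be its coordinate-deletion bundle (defined in the context), and fix a nonzero element $v\in D$. On each standard chart $U_i$ put $s_i(p)=M_i(p)v=q_i(p)v$. Then the local sections $s_i$ glue to a global section $$s_v:\mathbb{RP}^d\longrightarrow E_D .$$ Its zero set is $Z(s_v)=\{P_0,\dots,P_d\}$, the set of coordinate points, and every zero is nondegenerate.
   Context: $D$ is a finite-dimensional unital (not necessarily associative) real composition division algebra with multiplicative quadratic norm $N:D\to\mathbb R$, $N(uv)=N(u)N(v)$, $N(1)=1$, whose polar form $\langle u,v\rangle=\frac12(N(u+v)-N(u)-N(v))$ is positive definite, and $d=\dim_{\mathbb R}D\in\{2,4,8\}$; thus $D\cong\mathbb C,\mathbb H$ or $\mathbb O$. Fix an ordered orthonormal basis $(e_0,\dots,e_{d-1})$ of $D$, identifying $D$ with $\mathbb R^d$. For $u\in D$, $L_u(v)=uv$ and $M(u)\in M_d(\mathbb R)$ is the matrix of $L_u$ in this basis. On $\mathbb{RP}^d=\{[\alpha_0:\cdots:\alpha_d]\}$ let $U_i=\{\alpha_i\neq0\}$, let $P_i=[0:\cdots:0:1:0:\cdots:0]$ ($1$ in position $i$, $i=0,\dots,d$) be the coordinate points, let $\sigma_i:\{0,\dots,d-1\}\to\{0,\dots,d\}\setminus\{i\}$ be the increasing bijection, define $q_i:U_i\to D$ by $q_i([\alpha])=\sum_{r=0}^{d-1}\frac{\alpha_{\sigma_i(r)}}{\alpha_i}e_r$, and put $M_i(p)=M(q_i(p))$.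 The bundle $E_D\to\mathbb{RP}^d$ is the rank-$d$ real vector bundle obtained by gluing the $U_i\times\mathbb R^d$ via the transition functions $g_{ij}=M_iM_j^{-1}:U_i\cap U_j\to\mathrm{GL}_d(\mathbb R)$ for $i\ne j$ (and $g_{ii}=I_d$), with the convention that local representatives of a vector satisfy $w_i=g_{ij}w_j$. A zero of a section is nondegenerate if the derivative at that point of a local representative of the section is invertible. *)

theory Defs
  imports "HOL-Analysis.Analysis"
begin

section \<open>Real composition division algebras\<close>

definition polar_form :: "('a::real_vector \<Rightarrow> real) \<Rightarrow> 'a \<Rightarrow> 'a \<Rightarrow> real" where
  "polar_form N u v = (N (u + v) - N u - N v) / 2"

text \<open>
  The algebra is the whole type \<open>'a\<close>, with multiplication not assumed associative. Since
  \<^const>\<open>dim\<close> is 0 on infinite-dimensional spaces, the last assumption includes finite-dimensionality.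
\<close>

locale composition_division_algebra =
  fixes mul :: "'a::real_vector \<Rightarrow> 'a \<Rightarrow> 'a"
    and one :: 'a
    and N :: "'a \<Rightarrow> real"
  assumes bilinear_mul: "bilinear mul"
    and one_left: "mul one u = u"
    and one_right: "mul u one = u"
    and left_division: "a \<noteq> 0 \<Longrightarrow> \<exists>!x. mul a x = b"
    and right_division: "a \<noteq> 0 \<Longrightarrow> \<exists>!x. mul x a = b"
    and norm_scale: "N (c *\<^sub>R u) = c\<^sup>2 * N u"
    and bilinear_polar: "bilinear (polar_form N)"
    and norm_mul: "N (mul u w) = N u * N w"
    and norm_one: "N one = 1"
    and polar_pos: "u \<noteq> 0 \<Longrightarrow> polar_form N u u > 0"
    and dim_cases: "dim (UNIV :: 'a set) \<in> {2, 4, 8}"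

text \<open>
  An ordered basis is a family indexed by a finite linearly ordered type \<open>'n\<close>, which plays the role of
  \<open>{0, \<dots>, d - 1}\<close>.
\<close>

definition orthonormal_basis :: "('a::real_vector \<Rightarrow> real) \<Rightarrow> ('n \<Rightarrow> 'a) \<Rightarrow> bool" where
  "orthonormal_basis N e \<longleftrightarrow>
     (\<forall>r t. polar_form N (e r) (e t) = (if r = t then 1 else 0)) \<and> span (range e) = UNIV"

definition coords :: "('n::finite \<Rightarrow> 'a::real_vector) \<Rightarrow> 'a \<Rightarrow> real ^ 'n" where
  "coords e u = (\<chi> r. representation (range e) u (e r))"

definition mul_matrix ::
  "('a::real_vector \<Rightarrow> 'a \<Rightarrow> 'a) \<Rightarrow> ('n::finite \<Rightarrow> 'a) \<Rightarrow> 'a \<Rightarrow> real ^ 'n ^ 'n" where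
  "mul_matrix mul e u = (\<chi> r c. coords e (mul u (e c)) $ r)"

section \<open>Real projective space\<close>

text \<open>Homogeneous coordinates are indexed by a finite type \<open>'m\<close>, so this is the space of lines
  in \<open>real ^ 'm\<close>, of dimension \<open>CARD('m) - 1\<close>.\<close>

definition proportional :: "real ^ 'm \<Rightarrow> real ^ 'm \<Rightarrow> bool" where
  "proportional x y \<longleftrightarrow> x \<noteq> 0 \<and> y \<noteq> 0 \<and> (\<exists>c. y = c *\<^sub>R x)"

lemma part_equivp_proportional: "part_equivp (proportional :: real ^ 'm::finite \<Rightarrow> _)"
proof (rule part_equivpI)
  have "proportional (axis undefined 1) (axis undefined 1 :: real ^ 'm)"
    unfolding proportional_def by (auto simp: axis_eq_0_iff intro: exI[of _ 1])
  then show "\<exists>x. proportional x (x :: real ^ 'm)" ..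
  show "symp (proportional :: real ^ 'm \<Rightarrow> _)"
  proof (rule sympI)
    fix x y :: "real ^ 'm"
    assume "proportional x y"
    then obtain c where c: "x \<noteq> 0" "y \<noteq> 0" "y = c *\<^sub>R x"
      unfolding proportional_def by blast
    then have "x = (1 / c) *\<^sub>R y" by auto
    with c show "proportional y x" unfolding proportional_def by blast
  qed
  show "transp (proportional :: real ^ 'm \<Rightarrow> _)"
    unfolding proportional_def by (rule transpI) (metis scaleR_scaleR)
qed

quotient_type 'm rproj = "real ^ 'm::finite" / partial: proportional
  morphisms rep_rproj homog
  by (rule part_equivp_proportional)

text \<open>\<open>ratio i k [\<alpha>] = \<alpha>\<^sub>k / \<alpha>\<^sub>i\<close>\<close>

lift_definition ratio :: "'m::finite \<Rightarrow> 'm \<Rightarrow> 'm rproj \<Rightarrow> real" is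
  "\<lambda>i k \<alpha>. \<alpha> $ k / \<alpha> $ i"
  by (auto simp: proportional_def)

lift_definition nonzero_coord :: "'m::finite \<Rightarrow> 'm rproj \<Rightarrow> bool" is
  "\<lambda>i \<alpha>. \<alpha> $ i \<noteq> 0"
  by (auto simp: proportional_def)

definition affine_open :: "'m::finite \<Rightarrow> 'm rproj set" where
  "affine_open i = {p. nonzero_coord i p}"

definition coord_point :: "'m::finite \<Rightarrow> 'm rproj" where
  "coord_point i = homog (axis i 1)"

definition quotient_topology :: "'a topology \<Rightarrow> ('a \<Rightarrow> 'b) \<Rightarrow> 'b topology" where
  "quotient_topology X f =
     topology (\<lambda>U. U \<subseteq> f ` topspace X \<and> openin X {x \<in> topspace X. f x \<in> U})"

lemma openin_quotient_topology:
  "openin (quotient_topology X f) U \<longleftrightarrow>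
     U \<subseteq> f ` topspace X \<and> openin X {x \<in> topspace X. f x \<in> U}"
proof -
  have "istopology (\<lambda>U. U \<subseteq> f ` topspace X \<and> openin X {x \<in> topspace X. f x \<in> U})"
    unfolding istopology_def
  proof (intro conjI allI impI)
    fix S T
    assume S: "S \<subseteq> f ` topspace X \<and> openin X {x \<in> topspace X. f x \<in> S}"
      and T: "T \<subseteq> f ` topspace X \<and> openin X {x \<in> topspace X. f x \<in> T}"
    show "S \<inter> T \<subseteq> f ` topspace X" using S by blast
    have "{x \<in> topspace X. f x \<in> S \<inter> T} =
        {x \<in> topspace X. f x \<in> S} \<inter> {x \<in> topspace X. f x \<in> T}" by blast
    then show "openin X {x \<in> topspace X. f x \<in> S \<inter> T}" using S T by (simp add: openin_Int)
  next
    fix \<K>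
    assume K: "\<forall>K\<in>\<K>. K \<subseteq> f ` topspace X \<and> openin X {x \<in> topspace X. f x \<in> K}"
    show "\<Union>\<K> \<subseteq> f ` topspace X" using K by blast
    have "{x \<in> topspace X. f x \<in> \<Union>\<K>} = (\<Union>K\<in>\<K>. {x \<in> topspace X. f x \<in> K})" by blast
    then show "openin X {x \<in> topspace X. f x \<in> \<Union>\<K>}" using K by (simp add: openin_clauses(3))
  qed
  then show ?thesis unfolding quotient_topology_def by (simp add: topology_inverse')
qed

lemma quotient_map_quotient_topology: "quotient_map X (quotient_topology X f) f"
proof -
  have "topspace (quotient_topology X f) = f ` topspace X"
  proof
    show "topspace (quotient_topology X f) \<subseteq> f ` topspace X"
      using openin_quotient_topology[of X f "topspace (quotient_topology X f)"] by simp
    have "{x \<in> topspace X. f x \<in> f ` topspace X} = topspace X" by blast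
    then have "openin (quotient_topology X f) (f ` topspace X)"
      by (simp add: openin_quotient_topology)
    then show "f ` topspace X \<subseteq> topspace (quotient_topology X f)" by (rule openin_subset)
  qed
  then show ?thesis by (auto simp: quotient_map_def openin_quotient_topology)
qed

definition rproj_topology :: "'m::finite rproj topology" where
  "rproj_topology = quotient_topology (top_of_set (- {0})) homog"

text \<open>
  With \<open>CARD('m) = CARD('n) + 1\<close>, this is the unique increasing bijection of the index type \<open>'n\<close>
  onto the complement of \<open>i\<close>.
\<close>

definition skip :: "'m::{finite,linorder} \<Rightarrow> 'n::{finite,linorder} \<Rightarrow> 'm" where
  "skip i = (THE f. strict_mono f \<and> range f = UNIV - {i})"

definition affine_coords ::
  "'m::{finite,linorder} \<Rightarrow> 'm rproj \<Rightarrow> real ^ 'n::{finite,linorder}" where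
  "affine_coords i p = (\<chi> r. ratio i (skip i r) p)"

definition affine_point ::
  "'m::{finite,linorder} \<Rightarrow> real ^ 'n::{finite,linorder} \<Rightarrow> 'm rproj" where
  "affine_point i = the_inv_into (affine_open i) (affine_coords i)"

section \<open>Vector bundles on projective space given by transition functions\<close>

text \<open>
  Throughout, \<open>g i j p\<close> is the transition matrix at \<open>p\<close> with the convention \<open>w\<^sub>i = g\<^sub>i\<^sub>j w\<^sub>j\<close>. A point of
  the disjoint union of the \<open>U\<^sub>i \<times> \<real>\<^sup>d\<close> is a triple \<open>(i, p, w)\<close>; a point of the total space is
  an equivalence class of such triples.
\<close>

type_synonym ('m, 'n) transition = "'m \<Rightarrow> 'm \<Rightarrow> 'm rproj \<Rightarrow> real ^ 'n ^ 'n"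
type_synonym ('m, 'n) bundle_point = "('m \<times> 'm rproj \<times> (real ^ 'n)) set"

definition glue_rel ::
  "('m::finite, 'n::finite) transition \<Rightarrow>
     (('m \<times> 'm rproj \<times> (real ^ 'n)) \<times> ('m \<times> 'm rproj \<times> (real ^ 'n))) set" where
  "glue_rel g = {((i, p, w), (j, p', w')).
     p = p' \<and> p \<in> affine_open i \<inter> affine_open j \<and> w = g i j p *v w'}"

definition bundle_class ::
  "('m::finite, 'n::finite) transition \<Rightarrow> 'm \<times> 'm rproj \<times> (real ^ 'n) \<Rightarrow> ('m, 'n) bundle_point" where
  "bundle_class g x = glue_rel g `` {x}"

definition total_space :: "('m::finite, 'n::finite) transition \<Rightarrow> ('m, 'n) bundle_point topology" where
  "total_space g =
     quotient_topology
       (sum_topology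
          (\<lambda>i. prod_topology (subtopology rproj_topology (affine_open i)) euclidean) UNIV)
       (bundle_class g)"

definition bundle_proj :: "('m::finite, 'n::finite) bundle_point \<Rightarrow> 'm rproj" where
  "bundle_proj X = (THE p. \<exists>i w. (i, p, w) \<in> X)"

text \<open>The zero vector of the fibre over \<open>p\<close> is the class represented by 0 in every trivialization.\<close>

definition fibre_zero :: "'m::finite rproj \<Rightarrow> ('m, 'n::finite) bundle_point" where
  "fibre_zero p = {(i, p, 0) | i. p \<in> affine_open i}"

definition local_rep ::
  "('m::finite rproj \<Rightarrow> ('m, 'n::finite) bundle_point) \<Rightarrow> 'm \<Rightarrow> 'm rproj \<Rightarrow> real ^ 'n" where
  "local_rep s i p = (THE w. (i, p, w) \<in> s p)"

text \<open>On a finite-dimensional domain, \<open>Ck k f\<close> says that all iterated directional derivatives of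
  order at most \<open>k\<close> exist and are continuous.\<close>

primrec Ck ::
  "nat \<Rightarrow> ('a::real_normed_vector \<Rightarrow> 'b::real_normed_vector) \<Rightarrow> bool" where
  "Ck 0 f \<longleftrightarrow> continuous_on UNIV f"
| "Ck (Suc k) f \<longleftrightarrow>
     (\<exists>f'. (\<forall>x. (f has_derivative f' x) (at x)) \<and> (\<forall>h. Ck k (\<lambda>x. f' x h)))"

definition smooth :: "('a::real_normed_vector \<Rightarrow> 'b::real_normed_vector) \<Rightarrow> bool" where
  "smooth f \<longleftrightarrow> (\<forall>k. Ck k f)"

definition local_expr ::
  "('m::{finite,linorder} rproj \<Rightarrow> ('m, 'n::{finite,linorder}) bundle_point) \<Rightarrow>
     'm \<Rightarrow> real ^ 'n::{finite,linorder} \<Rightarrow> real ^ 'n::{finite,linorder}" where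
  "local_expr s i x = local_rep s i (affine_point i x)"

definition global_section ::
  "('m::{finite,linorder}, 'n::{finite,linorder}) transition \<Rightarrow>
     ('m rproj \<Rightarrow> ('m, 'n) bundle_point) \<Rightarrow> bool" where
  "global_section g s \<longleftrightarrow>
     continuous_map rproj_topology (total_space g) s \<and>
     (\<forall>p. bundle_proj (s p) = p) \<and>
     (\<forall>i. smooth (local_expr s i))"

definition zero_set :: "('m::finite rproj \<Rightarrow> ('m, 'n::finite) bundle_point) \<Rightarrow> 'm rproj set" where
  "zero_set s = {p. s p = fibre_zero p}"

definition nondegenerate_at ::
  "('m::{finite,linorder} rproj \<Rightarrow> ('m, 'n::{finite,linorder}) bundle_point) \<Rightarrow>
     'm rproj \<Rightarrow> bool" where
  "nondegenerate_at s p \<longleftrightarrow>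
     (\<forall>i. p \<in> affine_open i \<longrightarrow>
        (\<exists>A. (local_expr s i has_derivative (\<lambda>h. A *v h)) (at (affine_coords i p)) \<and> invertible A))"

section \<open>The coordinate-deletion bundle\<close>

definition chart_elem ::
  "('n::{finite,linorder} \<Rightarrow> 'a::real_vector) \<Rightarrow> 'm::{finite,linorder} \<Rightarrow> 'm rproj \<Rightarrow> 'a" where
  "chart_elem e i p = (\<Sum>r\<in>UNIV. ratio i (skip i r) p *\<^sub>R e r)"

definition chart_matrix ::
  "('a::real_vector \<Rightarrow> 'a \<Rightarrow> 'a) \<Rightarrow> ('n::{finite,linorder} \<Rightarrow> 'a) \<Rightarrow>
     'm::{finite,linorder} \<Rightarrow> 'm rproj \<Rightarrow> real ^ 'n::{finite,linorder} ^ 'n::{finite,linorder}" where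
  "chart_matrix mul e i p = mul_matrix mul e (chart_elem e i p)"

definition deletion_transition ::
  "('a::real_vector \<Rightarrow> 'a \<Rightarrow> 'a) \<Rightarrow> ('n::{finite,linorder} \<Rightarrow> 'a) \<Rightarrow>
     ('m::{finite,linorder}, 'n) transition" where
  "deletion_transition mul e i j p =
     (if i = j then mat 1 else chart_matrix mul e i p ** matrix_inv (chart_matrix mul e j p))"

definition mult_section ::
  "('a::real_vector \<Rightarrow> 'a \<Rightarrow> 'a) \<Rightarrow> ('n::{finite,linorder} \<Rightarrow> 'a) \<Rightarrow> 'a \<Rightarrow>
     'm::{finite,linorder} \<Rightarrow> 'm rproj \<Rightarrow> real ^ 'n::{finite,linorder}" where
  "mult_section mul e v i p = chart_matrix mul e i p *v coords e v"

definition glues_to ::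
  "('m::finite, 'n::finite) transition \<Rightarrow> ('m \<Rightarrow> 'm rproj \<Rightarrow> real ^ 'n) \<Rightarrow>
     ('m rproj \<Rightarrow> ('m, 'n) bundle_point) \<Rightarrow> bool" where
  "glues_to g f s \<longleftrightarrow> (\<forall>i. \<forall>p \<in> affine_open i. s p = bundle_class g (i, p, f i p))"

end

theory Submission
  imports Defs
begin

text \<open>
  Write a line as \<open>p\<close> and its chart element as \<open>q\<^sub>i(p)\<close>. On \<open>U\<^sub>i \<inter> U\<^sub>j\<close> with \<open>i \<noteq> j\<close>, the \<open>j\<close>-th affine
  coordinate of \<open>p\<close> is nonzero, so \<open>q\<^sub>i(p) \<noteq> 0\<close>, and left multiplication by it is invertible because
  the algebra has no zero divisors (\<open>chart_matrix_invertible\<close>). Therefore the matrices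
  \<open>g\<^sub>i\<^sub>j = M\<^sub>i M\<^sub>j\<^sup>-\<^sup>1\<close> exist and form a cocycle (\<open>cocycle_deletion_transition\<close>), gluing is an equivalence
  relation, and \<open>g\<^sub>i\<^sub>j (M\<^sub>j v) = M\<^sub>i v\<close> is immediate. This is the compatibility that makes the local
  sections \<open>M\<^sub>i v\<close> define a global one (\<open>compatible_family_glues\<close>).

  The rest follows from one observation: in the affine chart \<open>U\<^sub>i \<cong> \<real>\<^sup>d\<close> the section is
  \<open>x \<mapsto> x v\<close>, which is linear in \<open>x\<close> and injective, since \<open>v \<noteq> 0\<close>
  (\<open>mult_section_right_mult\<close>, \<open>inj_right_mult\<close>). A linear map is smooth and is its own derivative, which
  gives smoothness and the nondegeneracy of every zero. Its only zero is the origin of the chart,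
  which is the coordinate point \<open>P\<^sub>i\<close>; as the charts cover projective space, the zeros are exactly the
  coordinate points.
\<close>

section \<open>Increasing enumeration of a punctured index set\<close>

text \<open>
  The rank of \<open>f x\<close> within the range of \<open>f\<close> equals the rank of \<open>x\<close>, and an element is
  determined by its rank, so the range alone determines \<open>f\<close>.
\<close>

lemma strict_mono_eq_if_range_eq:
  fixes f g :: "'n::{finite,linorder} \<Rightarrow> 'm::linorder"
  assumes f: "strict_mono f" and g: "strict_mono g" and eq: "range f = range g"
  shows "f = g"
proof
  fix x
  have rank: "card {y \<in> range h. y < h x} = card {z. z < x}"
    if "strict_mono h" for h :: "'n \<Rightarrow> 'm"
  proof -
    have "{y \<in> range h. y < h x} = h ` {z. z < x}"
      using strict_mono_less[OF that] by auto
    moreover have "inj_on h {z. z < x}"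
      using strict_mono_imp_inj_on[OF that, of UNIV] by (rule inj_on_subset) simp
    ultimately show ?thesis by (simp add: card_image)
  qed
  have less: "card {y \<in> range f. y < a} < card {y \<in> range f. y < b}"
    if "a < b" "a \<in> range f" for a b
  proof (rule psubset_card_mono)
    show "finite {y \<in> range f. y < b}" by simp
    show "{y \<in> range f. y < a} \<subset> {y \<in> range f. y < b}" using that by fastforce
  qed
  have "f x \<in> range f" "g x \<in> range f" using eq by auto
  moreover have "card {y \<in> range f. y < f x} = card {y \<in> range f. y < g x}"
    using rank[OF f] rank[OF g] eq by simp
  ultimately show "f x = g x"
    using less[of "f x" "g x"] less[of "g x" "f x"] by (metis less_irrefl neqE)
qed

text \<open>Send each index to the element of \<open>A\<close> that has the same rank.\<close>

lemma ex_strict_mono_range: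
  fixes A :: "'m::linorder set"
  assumes "finite A" and card: "card A = CARD('n::{finite,linorder})"
  shows "\<exists>f :: 'n \<Rightarrow> 'm. strict_mono f \<and> range f = A"
proof -
  let ?xs = "sorted_list_of_set A"
  define f where "f x = ?xs ! card {z. z < x}" for x :: 'n
  have len: "card {z. z < x} < length ?xs" for x :: 'n
    using psubset_card_mono[of UNIV "{z. z < x}"] by (auto simp: card)
  have "strict_mono f"
  proof (rule strict_monoI)
    fix x y :: 'n assume "x < y"
    then have "card {z. z < x} < card {z. z < y}"
      by (intro psubset_card_mono) (auto intro: less_trans)
    then show "f x < f y"
      unfolding f_def using len strict_sorted_list_of_set sorted_wrt_nth_less by blast
  qed
  moreover have "range f = A"
  proof (rule card_subset_eq)
    show "range f \<subseteq> A"
      using nth_mem[OF len] \<open>finite A\<close> by (auto simp: f_def)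
    show "card (range f) = card A"
      using strict_mono_imp_inj_on[OF \<open>strict_mono f\<close>, of UNIV] by (simp add: card card_image)
  qed fact
  ultimately show ?thesis by blast
qed

lemma
  fixes i :: "'m::{finite,linorder}"
  assumes "CARD('m) = CARD('n::{finite,linorder}) + 1"
  shows inj_skip: "inj (skip i :: 'n \<Rightarrow> 'm)"
    and range_skip: "range (skip i :: 'n \<Rightarrow> 'm) = UNIV - {i}"
proof -
  have "card (UNIV - {i}) = CARD('n)" using assms by simp
  then have ex: "\<exists>f :: 'n \<Rightarrow> 'm. strict_mono f \<and> range f = UNIV - {i}"
    by (intro ex_strict_mono_range) simp_all
  have "\<exists>!f :: 'n \<Rightarrow> 'm. strict_mono f \<and> range f = UNIV - {i}"
  proof (rule ex_ex1I[OF ex])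
    fix f h :: "'n \<Rightarrow> 'm"
    assume "strict_mono f \<and> range f = UNIV - {i}" "strict_mono h \<and> range h = UNIV - {i}"
    then show "f = h" by (intro strict_mono_eq_if_range_eq) simp_all
  qed
  then have *: "strict_mono (skip i :: 'n \<Rightarrow> 'm) \<and> range (skip i :: 'n \<Rightarrow> 'm) = UNIV - {i}"
    unfolding skip_def by (rule theI')
  then show "inj (skip i :: 'n \<Rightarrow> 'm)" "range (skip i :: 'n \<Rightarrow> 'm) = UNIV - {i}"
    by (simp_all add: strict_mono_imp_inj_on)
qed


section \<open>Affine charts of projective space\<close>

lemma proportional_refl: "proportional x x \<longleftrightarrow> x \<noteq> 0"
  by (auto simp: proportional_def intro: exI[of _ 1])

lemma homog_cases:
  obtains x where "x \<noteq> 0" and "p = homog x"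
  by (induction p rule: rproj.abs_induct) (auto simp: proportional_refl)

lemma homog_eqI: "x \<noteq> 0 \<Longrightarrow> y \<noteq> 0 \<Longrightarrow> y = c *\<^sub>R x \<Longrightarrow> homog x = homog y"
  using Quotient_rel_abs[OF Quotient_rproj, of x y] by (auto simp: proportional_def)

lemma ratio_homog: "x \<noteq> 0 \<Longrightarrow> ratio i k (homog x) = x $ k / x $ i"
  by (rule ratio.abs_eq) (simp add: proportional_refl)

lemma homog_in_affine_open: "x \<noteq> 0 \<Longrightarrow> homog x \<in> affine_open i \<longleftrightarrow> x $ i \<noteq> 0"
  by (simp add: affine_open_def nonzero_coord.abs_eq proportional_refl)

lemma homog_in_affine_openI: "x $ i \<noteq> 0 \<Longrightarrow> homog x \<in> affine_open i"
  by (subst homog_in_affine_open) auto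

lemma affine_open_cover: obtains i where "p \<in> affine_open i"
proof (cases p rule: homog_cases)
  case (1 x)
  then obtain i where "x $ i \<noteq> 0" by (auto simp: vec_eq_iff)
  with 1 that show thesis by (simp add: homog_in_affine_open)
qed

lemma affine_coords_homog:
  "x \<noteq> 0 \<Longrightarrow> affine_coords i (homog x) = (\<chi> r. x $ skip i r / x $ i)"
  by (simp add: affine_coords_def ratio_homog)

lemma coord_point_in_affine_open: "coord_point i \<in> affine_open i"
  by (simp add: coord_point_def homog_in_affine_open axis_eq_0_iff)

lemma inj_on_affine_coords:
  assumes "CARD('m::{finite,linorder}) = CARD('n::{finite,linorder}) + 1"
  shows "inj_on (affine_coords i :: 'm::{finite,linorder} rproj \<Rightarrow> real ^ 'n::{finite,linorder})
           (affine_open i)"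
proof (rule inj_onI)
  fix p q :: "'m rproj"
  assume p: "p \<in> affine_open i" and q: "q \<in> affine_open i"
    and eq: "(affine_coords i p :: (real, 'n) vec) = affine_coords i q"
  obtain x where x: "x \<noteq> 0" "p = homog x" by (rule homog_cases)
  obtain y where y: "y \<noteq> 0" "q = homog y" by (rule homog_cases)
  have nz: "x $ i \<noteq> 0" "y $ i \<noteq> 0" using p q x y by (simp_all add: homog_in_affine_open)
  \<comment> \<open>The factor is forced by the \<open>i\<close>-th coordinates.\<close>
  define c where "c = y $ i / x $ i"
  have "y $ k = c * x $ k" for k
  proof (cases "k = i")
    case False
    then obtain r where "k = skip i (r :: 'n)" using range_skip[OF assms, of i] by blast
    then have "x $ k / x $ i = y $ k / y $ i"
      using eq x y by (simp add: affine_coords_homog vec_eq_iff)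
    with nz show ?thesis by (simp add: c_def field_simps)
  qed (use nz in \<open>simp add: c_def\<close>)
  then have "y = c *\<^sub>R x" by (simp add: vec_eq_iff)
  then have "homog x = homog y" by (rule homog_eqI[OF x(1) y(1)])
  then show "p = q" by (simp only: x(2) y(2))
qed

text \<open>The preimage is the line with \<open>i\<close>-th homogeneous coordinate 1 and the others given by \<open>w\<close>.\<close>

lemma affine_coords_surj:
  fixes w :: "real ^ 'n::{finite,linorder}"
  assumes "CARD('m::{finite,linorder}) = CARD('n) + 1"
  obtains p :: "'m::{finite,linorder} rproj" where "p \<in> affine_open i" and "affine_coords i p = w"
proof -
  define x :: "(real, 'm) vec" where "x = (\<chi> k. if k = i then 1 else w $ the_inv (skip i) k)"
  have xi: "x $ i = 1" by (simp add: x_def)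
  then have x0: "x \<noteq> 0" by auto
  have "x $ skip i r = w $ r" for r
    using range_skip[OF assms, of i] inj_skip[OF assms, of i]
    by (auto simp: x_def the_inv_f_f)
  then have "affine_coords i (homog x) = w"
    using x0 xi by (simp add: affine_coords_homog vec_eq_iff)
  with that[of "homog x"] x0 xi show thesis by (simp add: homog_in_affine_open)
qed

lemma
  fixes w :: "real ^ 'n::{finite,linorder}"
  assumes "CARD('m::{finite,linorder}) = CARD('n) + 1"
  shows affine_point_in_affine_open: "(affine_point i w :: 'm::{finite,linorder} rproj) \<in> affine_open i"
    and affine_coords_affine_point: "affine_coords i (affine_point i w :: 'm::{finite,linorder} rproj) = w"
proof -
  obtain p :: "'m rproj" where p: "p \<in> affine_open i" "affine_coords i p = w"
    using assms by (rule affine_coords_surj)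
  then have "affine_point i w = p"
    unfolding affine_point_def using inj_on_affine_coords[OF assms] by (auto simp: the_inv_into_f_f)
  with p show "(affine_point i w :: 'm rproj) \<in> affine_open i"
    "affine_coords i (affine_point i w :: 'm rproj) = w" by simp_all
qed

lemma affine_coords_coord_point:
  assumes "CARD('m::{finite,linorder}) = CARD('n::{finite,linorder}) + 1"
  shows "affine_coords i (coord_point i :: 'm::{finite,linorder} rproj) =
           (0 :: real ^ 'n::{finite,linorder})"
proof -
  have "skip i r \<noteq> i" for r :: 'n
    using range_skip[OF assms, of i] rangeI[of "skip i" r] by simp
  moreover have "axis i (1 :: real) \<noteq> 0" by (simp add: axis_eq_0_iff)
  ultimately show ?thesis
    by (simp add: coord_point_def affine_coords_homog axis_def vec_eq_iff)
qed

lemma affine_coords_eq_0_iff: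
  fixes p :: "'m::{finite,linorder} rproj"
  assumes "CARD('m) = CARD('n::{finite,linorder}) + 1" and "p \<in> affine_open i"
  shows "affine_coords i p = (0 :: real ^ 'n::{finite,linorder}) \<longleftrightarrow> p = coord_point i"
  using inj_on_affine_coords[OF assms(1), of i] affine_coords_coord_point[OF assms(1), of i]
    coord_point_in_affine_open[of i] assms(2)
  by (metis inj_onD)

text \<open>
  Only the coordinate point \<open>P\<^sub>i\<close> has all affine coordinates zero in the chart \<open>U\<^sub>i\<close>, and it lies in
  no other chart.
\<close>

lemma affine_coords_nonzero_if_overlap:
  fixes p :: "'m::{finite,linorder} rproj"
  assumes card: "CARD('m) = CARD('n::{finite,linorder}) + 1"
    and p: "p \<in> affine_open i" "p \<in> affine_open j" and "i \<noteq> j"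
  shows "affine_coords i p \<noteq> (0 :: real ^ 'n::{finite,linorder})"
proof -
  have "coord_point i \<notin> affine_open j"
    using \<open>i \<noteq> j\<close>
    by (simp add: coord_point_def homog_in_affine_open axis_eq_0_iff) (simp add: axis_def)
  with p show ?thesis using affine_coords_eq_0_iff[OF card p(1)] by auto
qed

lemma quotient_map_homog: "quotient_map (top_of_set (- {0})) rproj_topology homog"
  unfolding rproj_topology_def by (rule quotient_map_quotient_topology)


section \<open>Gluing compatible local sections\<close>

definition cocycle :: "('m::finite, 'n::finite) transition \<Rightarrow> bool" where
  "cocycle g \<longleftrightarrow> (\<forall>i p. g i i p = mat 1) \<and>
     (\<forall>i j k p. p \<in> affine_open i \<inter> affine_open j \<inter> affine_open k \<longrightarrow>
        g i j p ** g j k p = g i k p)"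

definition compatible_family ::
  "('m::finite, 'n::finite) transition \<Rightarrow> ('m \<Rightarrow> 'm rproj \<Rightarrow> real ^ 'n) \<Rightarrow> bool" where
  "compatible_family g f \<longleftrightarrow>
     (\<forall>i j. \<forall>p \<in> affine_open i \<inter> affine_open j. f i p = g i j p *v f j p)"

lemma compatible_familyD:
  "compatible_family g f \<Longrightarrow> p \<in> affine_open i \<Longrightarrow> p \<in> affine_open j \<Longrightarrow>
     f i p = g i j p *v f j p"
  unfolding compatible_family_def by blast

lemma cocycle_inverse:
  assumes "cocycle g" and "p \<in> affine_open i" "p \<in> affine_open j"
  shows "g i j p *v (g j i p *v w) = w"
  using assms by (simp add: cocycle_def matrix_vector_mul_assoc)

text \<open>
  The cocycle identity rewrites membership of \<open>(j, p, w)\<close> in the class of the \<open>i\<close>-th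
  representative as \<open>w = g\<^sub>j\<^sub>i f\<^sub>i(p)\<close>, and compatibility says that this is \<open>f\<^sub>j(p)\<close>. So the class does
  not depend on \<open>i\<close>.
\<close>

lemma bundle_class_compatible:
  assumes g: "cocycle g" and f: "compatible_family g f" and p: "p \<in> affine_open i"
  shows "bundle_class g (i, p, f i p) = {(j, p, f j p) | j. p \<in> affine_open j}"
proof -
  have "f i p = g i j p *v w \<longleftrightarrow> w = f j p" if j: "p \<in> affine_open j" for j w
  proof
    assume "f i p = g i j p *v w"
    then have "g j i p *v f i p = w" using cocycle_inverse[OF g j p] by simp
    then show "w = f j p" using compatible_familyD[OF f j p] by simp
  qed (use compatible_familyD[OF f p j] in simp)
  then show ?thesis using p by (auto simp: bundle_class_def glue_rel_def)
qed

text \<open>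
  The value at \<open>p\<close> is the equivalence class of \<open>(i, p, f\<^sub>i(p))\<close> for any chart \<open>i\<close> around \<open>p\<close>, written
  without a choice of \<open>i\<close>.
\<close>

definition glue ::
  "('m \<Rightarrow> 'm rproj \<Rightarrow> real ^ 'n) \<Rightarrow> 'm::finite rproj \<Rightarrow> ('m, 'n::finite) bundle_point" where
  "glue f p = {(j, p, f j p) | j. p \<in> affine_open j}"

lemma compatible_family_glues:
  fixes g :: "('m::finite, 'n::finite) transition"
  assumes "cocycle g" and "compatible_family g f"
  shows "glues_to g f s \<longleftrightarrow> s = glue f"
proof
  assume s: "glues_to g f s"
  show "s = glue f"
  proof
    fix p :: "'m rproj"
    obtain i where "p \<in> affine_open i" by (rule affine_open_cover)
    with s assms show "s p = glue f p"
      by (simp add: glues_to_def bundle_class_compatible glue_def)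
  qed
qed (use assms in \<open>simp add: glues_to_def bundle_class_compatible glue_def\<close>)

lemma bundle_proj_glue: "bundle_proj (glue f p) = p"
proof -
  obtain i where "p \<in> affine_open i" by (rule affine_open_cover)
  then show ?thesis unfolding bundle_proj_def glue_def by (intro the_equality) auto
qed

lemma local_rep_glue: "p \<in> affine_open i \<Longrightarrow> local_rep (glue f) i p = f i p"
  by (auto simp: local_rep_def glue_def)

text \<open>Transition matrices are linear, so a vector that is zero in one chart is zero in all charts.\<close>

lemma glue_eq_fibre_zero_iff:
  assumes "cocycle g" and "compatible_family g f" and "p \<in> affine_open i"
  shows "glue f p = fibre_zero p \<longleftrightarrow> f i p = 0"
proof
  assume "glue f p = fibre_zero p"
  then have "(i, p, f i p) \<in> fibre_zero p" using assms(3) by (auto simp: glue_def)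
  then show "f i p = 0" by (auto simp: fibre_zero_def)
next
  assume "f i p = 0"
  then have "f j p = 0" if "p \<in> affine_open j" for j
    using compatible_familyD[OF assms(2) that assms(3)] by simp
  then show "glue f p = fibre_zero p" by (auto simp: glue_def fibre_zero_def)
qed

text \<open>
  Both topologies involved are quotient topologies, so continuity may be tested upstairs: on the
  punctured coordinate space, and, over each of the open sets \<open>x\<^sub>i \<noteq> 0\<close>, by factoring the section
  through the \<open>i\<close>-th summand of the disjoint union that is glued.
\<close>

lemma continuous_map_glue:
  fixes f :: "'m::finite \<Rightarrow> 'm rproj \<Rightarrow> real ^ 'n::finite"
  assumes g: "cocycle g" and f: "compatible_family g f"
    and cont: "\<And>i. continuous_on {x. x $ i \<noteq> 0} (\<lambda>x. f i (homog x))"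
  shows "continuous_map rproj_topology (total_space g) (glue f)"
proof -
  let ?X = "top_of_set (- {0 :: real ^ 'm})"
  let ?V = "\<lambda>i::'m. {x :: real ^ 'm. x $ i \<noteq> 0}"
  let ?Y = "\<lambda>i. prod_topology (subtopology rproj_topology (affine_open i))
                  (euclidean :: (real ^ 'n) topology)"
  have sub: "subtopology ?X (?V i) = top_of_set (?V i)" for i
    by (auto simp: subtopology_subtopology intro!: arg_cong[of _ _ top_of_set])
  have openV: "openin ?X (?V i)" for i
  proof -
    have "open (?V i)" by (intro open_Collect_neq continuous_intros)
    then show ?thesis by (subst openin_open_eq) auto
  qed
  have local: "continuous_map (subtopology ?X (?V i)) (total_space g) (glue f \<circ> homog)" for i
  proof -
    have "continuous_map (top_of_set (?V i)) rproj_topology homog"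
      using quotient_imp_continuous_map[OF quotient_map_homog]
      by (metis sub continuous_map_from_subtopology)
    then have "continuous_map (top_of_set (?V i)) (?Y i) (\<lambda>x. (homog x, f i (homog x)))"
      using cont[of i]
      by (intro continuous_map_pairedI)
        (auto simp: continuous_map_in_subtopology homog_in_affine_openI)
    then have "continuous_map (top_of_set (?V i)) (sum_topology ?Y UNIV)
        (Pair i \<circ> (\<lambda>x. (homog x, f i (homog x))))"
      by (rule continuous_map_compose)
        (rule continuous_map_component_injection[of i UNIV ?Y, OF UNIV_I])
    then have "continuous_map (top_of_set (?V i)) (total_space g)
        (bundle_class g \<circ> (Pair i \<circ> (\<lambda>x. (homog x, f i (homog x)))))"
      unfolding total_space_def
      by (rule continuous_map_compose)
        (rule quotient_imp_continuous_map[OF quotient_map_quotient_topology])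
    moreover have "(bundle_class g \<circ> (Pair i \<circ> (\<lambda>x. (homog x, f i (homog x))))) x
        = (glue f \<circ> homog) x" if "x \<in> ?V i" for x
    proof -
      from that have "homog x \<in> affine_open i" by (simp add: homog_in_affine_openI)
      then show ?thesis using g f by (simp add: bundle_class_compatible glue_def)
    qed
    ultimately show ?thesis unfolding sub by (rule continuous_map_eq) simp
  qed
  have "continuous_map ?X (total_space g) (glue f \<circ> homog)"
  proof (rule pasting_lemma[where I = UNIV and T = ?V and f = "\<lambda>_. glue f \<circ> homog"])
    show "\<exists>j. j \<in> UNIV \<and> x \<in> ?V j \<and> (glue f \<circ> homog) x = (glue f \<circ> homog) x"
      if "x \<in> topspace ?X" for x
      using that by (auto simp: vec_eq_iff)
  qed (use openV local in auto)
  then show ?thesis using continuous_compose_quotient_map_eq[OF quotient_map_homog] by blast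
qed


section \<open>Linear maps are smooth\<close>

lemma Ck_const: "Ck k (\<lambda>_. c)"
proof (induction k arbitrary: c)
  case (Suc k)
  have "((\<lambda>_. c) has_derivative (\<lambda>_. 0)) (at x)" for x by simp
  with Suc show ?case by (auto intro!: exI[of _ "\<lambda>_ _. 0"])
qed simp

text \<open>The derivative is the same at every point, so all directional derivatives are constant.\<close>

lemma smooth_bounded_linear:
  assumes "bounded_linear f"
  shows "smooth f"
proof -
  have "Ck k f" for k
  proof (cases k)
    case 0
    then show ?thesis using assms by (simp add: linear_continuous_on)
  next
    case (Suc k')
    then show ?thesis
      using bounded_linear_imp_has_derivative[OF assms] by (auto intro!: exI[of _ "\<lambda>_. f"] Ck_const)
  qed
  then show ?thesis by (simp add: smooth_def)
qed


section \<open>Coordinates and multiplication matrices\<close>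

definition of_coords :: "('n::finite \<Rightarrow> 'a::real_vector) \<Rightarrow> real ^ 'n \<Rightarrow> 'a" where
  "of_coords e x = (\<Sum>r\<in>UNIV. x $ r *\<^sub>R e r)"

lemma linear_of_coords: "linear (of_coords e)"
  by (rule linearI) (simp_all add: of_coords_def scaleR_left_distrib sum.distrib scaleR_sum_right)

lemma
  fixes A :: "real ^ 'k::finite ^ 'k"
  assumes "invertible A"
  shows matrix_inv_right: "A ** matrix_inv A = mat 1"
    and matrix_inv_left_cancel: "matrix_inv A ** (A ** B) = B"
    and matrix_inv_left_cancel_vec: "matrix_inv A *v (A *v x) = x"
proof -
  have "A ** matrix_inv A = mat 1 \<and> matrix_inv A ** A = mat 1"
    using assms unfolding invertible_def matrix_inv_def by (rule someI_ex)
  then show "A ** matrix_inv A = mat 1" "matrix_inv A ** (A ** B) = B"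
    "matrix_inv A *v (A *v x) = x"
    by (simp_all add: matrix_mul_assoc matrix_vector_mul_assoc)
qed

lemma chart_elem_of_coords: "chart_elem e i p = of_coords e (affine_coords i p)"
  by (simp add: chart_elem_def of_coords_def affine_coords_def)

context
  fixes N :: "'a::real_vector \<Rightarrow> real" and e :: "'n::finite \<Rightarrow> 'a"
  assumes polar: "bilinear (polar_form N)" and basis: "orthonormal_basis N e"
begin

text \<open>
  Pairing with the basis vectors recovers the coefficients of a linear combination. This gives the
  injectivity of \<^const>\<open>of_coords\<close>, hence the independence that makes \<^const>\<open>coords\<close> meaningful.
\<close>

lemma polar_form_of_coords: "polar_form N (of_coords e x) (e t) = x $ t"
proof -
  have lin: "linear (\<lambda>u. polar_form N u (e t))" using polar by (simp add: bilinear_def)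
  have "polar_form N (of_coords e x) (e t) = (\<Sum>r\<in>UNIV. x $ r * polar_form N (e r) (e t))"
    unfolding of_coords_def by (simp add: linear_sum[OF lin] linear_cmul[OF lin])
  also have "\<dots> = (\<Sum>r\<in>UNIV. if r = t then x $ r else 0)"
    using basis by (intro sum.cong) (auto simp: orthonormal_basis_def)
  finally show ?thesis by simp
qed

lemma inj_of_coords: "inj (of_coords e)"
  by (rule injI) (metis polar_form_of_coords vec_eq_iff)

lemma inj_orthonormal_basis: "inj e"
proof (rule injI)
  fix r t assume eq: "e r = e t"
  have "polar_form N (e r) (e t) = (if r = t then 1 else 0)" "polar_form N (e r) (e r) = 1"
    using basis by (simp_all add: orthonormal_basis_def)
  with eq show "r = t" by (simp split: if_splits)
qed

lemma independent_orthonormal_basis: "independent (range e)"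
proof (rule independent_if_scalars_zero)
  fix c b assume sum0: "(\<Sum>b\<in>range e. c b *\<^sub>R b) = 0" and b: "b \<in> range e"
  have "of_coords e (\<chi> r. c (e r)) = of_coords e 0"
    using sum0 sum.reindex[OF inj_orthonormal_basis, of "\<lambda>b. c b *\<^sub>R b"] by (simp add: of_coords_def)
  then have "(\<chi> r. c (e r)) = 0" using inj_of_coords by (rule injD[rotated])
  with b show "c b = 0" by (auto simp: vec_eq_iff)
qed simp

lemma of_coords_coords: "of_coords e (coords e u) = u"
proof -
  have "u = (\<Sum>b\<in>range e. representation (range e) u b *\<^sub>R b)"
    using basis independent_orthonormal_basis
    by (intro real_vector.sum_representation_eq[symmetric]) (auto simp: orthonormal_basis_def)
  then show ?thesis
    using sum.reindex[OF inj_orthonormal_basis, of "\<lambda>b. representation (range e) u b *\<^sub>R b"]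
    by (simp add: of_coords_def coords_def)
qed

lemma coords_of_coords: "coords e (of_coords e x) = x"
  using of_coords_coords inj_of_coords by (metis injD)

lemma linear_coords: "linear (coords e)"
proof (rule linearI)
  interpret of_coords: linear "of_coords e" by (rule linear_of_coords)
  show "coords e (u + w) = coords e u + coords e w" for u w
    by (metis coords_of_coords of_coords_coords of_coords.add)
  show "coords e (c *\<^sub>R u) = c *\<^sub>R coords e u" for c u
    by (metis coords_of_coords of_coords_coords of_coords.scaleR)
qed

lemma coords_eq_0_iff: "coords e u = 0 \<longleftrightarrow> u = 0"
  by (metis coords_of_coords of_coords_coords linear_0 linear_of_coords)

lemma mul_matrix_mult_vec:
  assumes "bilinear mul"
  shows "mul_matrix mul e u *v x = coords e (mul u (of_coords e x))"
proof -
  have lin: "linear (\<lambda>w. coords e (mul u w))"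
    using linear_compose[OF _ linear_coords, of "mul u"] assms by (simp add: bilinear_def o_def)
  have "coords e (mul u (of_coords e x)) = (\<Sum>c\<in>UNIV. x $ c *\<^sub>R coords e (mul u (e c)))"
    unfolding of_coords_def by (simp add: linear_sum[OF lin] linear_cmul[OF lin])
  then show ?thesis
    by (simp add: vec_eq_iff matrix_vector_mult_def mul_matrix_def mult.commute)
qed

end


section \<open>The coordinate-deletion bundle and its sections\<close>

context composition_division_algebra
begin

lemma mul_eq_0_iff: "mul a x = 0 \<longleftrightarrow> a = 0 \<or> x = 0"
  using left_division[of a 0] bilinear_lzero[OF bilinear_mul] bilinear_rzero[OF bilinear_mul]
  by metis

context
  fixes e :: "'n::{finite,linorder} \<Rightarrow> 'a"
  assumes basis: "orthonormal_basis N e"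
begin

lemma of_coords_eq_0_iff: "of_coords e x = 0 \<longleftrightarrow> x = 0"
  using inj_of_coords[OF bilinear_polar basis] linear_injective_0[OF linear_of_coords, of e]
    linear_0[OF linear_of_coords, of e] by metis

lemma invertible_mul_matrix:
  assumes "u \<noteq> 0"
  shows "invertible (mul_matrix mul e u)"
proof -
  have "x = 0" if "mul_matrix mul e u *v x = 0" for x
    using that assms
    by (simp add: mul_matrix_mult_vec[OF bilinear_polar basis bilinear_mul]
        coords_eq_0_iff[OF bilinear_polar basis] mul_eq_0_iff of_coords_eq_0_iff)
  then show ?thesis
    using matrix_left_invertible_ker[of "mul_matrix mul e u"] invertible_left_inverse by blast
qed

text \<open>
  The matrix of left multiplication by a nonzero element is invertible, and on an overlap of two
  charts the chart element is nonzero. At \<open>P\<^sub>i\<close> itself the matrix is zero, so the second chart is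
  essential.
\<close>

lemma chart_matrix_invertible:
  fixes p :: "'m::{finite,linorder} rproj"
  assumes "CARD('m) = CARD('n) + 1"
    and "p \<in> affine_open i" and "p \<in> affine_open j" and "i \<noteq> j"
  shows "invertible (chart_matrix mul e i p)"
  unfolding chart_matrix_def chart_elem_of_coords
  using affine_coords_nonzero_if_overlap[OF assms]
  by (intro invertible_mul_matrix) (simp add: of_coords_eq_0_iff)

text \<open>
  For \<open>i \<noteq> j \<noteq> k\<close> the middle factors of \<open>M\<^sub>i M\<^sub>j\<^sup>-\<^sup>1 M\<^sub>j M\<^sub>k\<^sup>-\<^sup>1\<close> cancel, as \<open>p\<close> lies in two charts and so \<open>M\<^sub>j\<close> is
  invertible; if moreover \<open>i = k\<close>, the result \<open>M\<^sub>i M\<^sub>i\<^sup>-\<^sup>1\<close> agrees with the separate convention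
  that \<open>g\<^sub>i\<^sub>i\<close> is the identity. That convention also settles \<open>i = j\<close> and \<open>j = k\<close>, where \<open>M\<^sub>j\<close> can be
  singular.
\<close>

lemma cocycle_deletion_transition:
  assumes card: "CARD('m::{finite,linorder}) = CARD('n) + 1"
  shows "cocycle (deletion_transition mul e :: ('m::{finite,linorder}, 'n) transition)"
  unfolding cocycle_def
proof (intro conjI allI impI)
  fix i j k :: 'm and p :: "'m rproj"
  let ?M = "\<lambda>i. chart_matrix mul e i p"
  show "deletion_transition mul e i i p = mat 1" by (simp add: deletion_transition_def)
  assume p: "p \<in> affine_open i \<inter> affine_open j \<inter> affine_open k"
  show "deletion_transition mul e i j p ** deletion_transition mul e j k p
      = deletion_transition mul e i k p"
  proof (cases "i = j \<or> j = k")
    case False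
    then have "invertible (?M j)" "i = k \<Longrightarrow> invertible (?M i)"
      using p chart_matrix_invertible[OF card] by auto
    then have "(?M i ** matrix_inv (?M j)) ** (?M j ** matrix_inv (?M k)) = ?M i ** matrix_inv (?M k)"
      and "i = k \<Longrightarrow> ?M i ** matrix_inv (?M k) = mat 1"
      by (simp_all add: matrix_mul_assoc[symmetric] matrix_inv_left_cancel matrix_inv_right)
    with False show ?thesis by (simp add: deletion_transition_def)
  qed (auto simp: deletion_transition_def)
qed

lemma compatible_mult_section:
  assumes card: "CARD('m::{finite,linorder}) = CARD('n) + 1"
  shows "compatible_family (deletion_transition mul e :: ('m::{finite,linorder}, 'n) transition)
           (mult_section mul e v)"
  unfolding compatible_family_def
proof (intro allI ballI)
  fix i j :: 'm and p assume "p \<in> affine_open i \<inter> affine_open j"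
  then have "i \<noteq> j \<Longrightarrow> invertible (chart_matrix mul e j p)"
    using chart_matrix_invertible[OF card, of p j i] by auto
  then show "mult_section mul e v i p = deletion_transition mul e i j p *v mult_section mul e v j p"
    by (auto simp: deletion_transition_def mult_section_def matrix_inv_left_cancel_vec
        matrix_vector_mul_assoc[symmetric])
qed

lemma mult_section_mul: "mult_section mul e v i p = coords e (mul (chart_elem e i p) v)"
  by (simp add: mult_section_def chart_matrix_def
      mul_matrix_mult_vec[OF bilinear_polar basis bilinear_mul] of_coords_coords[OF bilinear_polar basis])

text \<open>Right multiplication by \<open>v\<close> in coordinates: the section \<open>s\<^sub>v\<close> as seen in any affine chart.\<close>

definition right_mult ::
  "'a \<Rightarrow> real ^ 'n::{finite,linorder} \<Rightarrow> real ^ 'n::{finite,linorder}" where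
  "right_mult v x = coords e (mul (of_coords e x) v)"

lemma mult_section_right_mult: "mult_section mul e v i p = right_mult v (affine_coords i p)"
  by (simp add: mult_section_mul chart_elem_of_coords right_mult_def)

lemma linear_right_mult: "linear (right_mult v)"
proof -
  have "linear (\<lambda>u. mul u v)" using bilinear_mul by (simp add: bilinear_def)
  then have "linear (coords e \<circ> ((\<lambda>u. mul u v) \<circ> of_coords e))"
    by (intro linear_compose linear_of_coords linear_coords[OF bilinear_polar basis])
  then show ?thesis by (simp add: right_mult_def[abs_def] o_def)
qed

lemma right_mult_eq_0_iff: "v \<noteq> 0 \<Longrightarrow> right_mult v x = 0 \<longleftrightarrow> x = 0"
  by (simp add: right_mult_def coords_eq_0_iff[OF bilinear_polar basis] mul_eq_0_iff
      of_coords_eq_0_iff)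

lemma inj_right_mult: "v \<noteq> 0 \<Longrightarrow> inj (right_mult v)"
  using linear_injective_0[OF linear_right_mult] right_mult_eq_0_iff by blast

lemma local_expr_glue_mult_section:
  assumes card: "CARD('m::{finite,linorder}) = CARD('n) + 1"
  shows "local_expr (glue (mult_section mul e v)) (i :: 'm::{finite,linorder}) = right_mult v"
  by (rule ext) (simp add: local_expr_def local_rep_glue[OF affine_point_in_affine_open[OF card]]
      mult_section_right_mult affine_coords_affine_point[OF card])

lemma global_section_glue_mult_section:
  assumes card: "CARD('m::{finite,linorder}) = CARD('n) + 1"
  shows "global_section (deletion_transition mul e :: ('m::{finite,linorder}, 'n) transition)
           (glue (mult_section mul e v))"
  unfolding global_section_def
proof (intro conjI allI)
  show "continuous_map rproj_topology (total_space (deletion_transition mul e :: ('m, 'n) transition))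
      (glue (mult_section mul e v))"
  proof (rule continuous_map_glue[OF cocycle_deletion_transition[OF card]
        compatible_mult_section[OF card]])
    fix i :: 'm
    have "continuous_on {x :: (real, 'm) vec. x $ i \<noteq> 0}
        (\<lambda>x. right_mult v (\<chi> r. x $ skip i r / x $ i))"
      by (rule linear_continuous_on_compose[OF _ linear_right_mult]) (auto intro!: continuous_intros)
    moreover have "mult_section mul e v i (homog x) = right_mult v (\<chi> r. x $ skip i r / x $ i)"
      if "x $ i \<noteq> 0" for x
      using that by (subst mult_section_right_mult, subst affine_coords_homog) auto
    ultimately show "continuous_on {x. x $ i \<noteq> 0} (\<lambda>x. mult_section mul e v i (homog x))"
      by (subst continuous_on_cong[OF refl]) auto
  qed
  show "smooth (local_expr (glue (mult_section mul e v)) i)" for i :: 'm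
    using linear_right_mult
    by (simp add: local_expr_glue_mult_section[OF card] smooth_bounded_linear linear_conv_bounded_linear)
qed (rule bundle_proj_glue)

lemma zero_set_glue_mult_section:
  assumes card: "CARD('m::{finite,linorder}) = CARD('n) + 1" and v: "v \<noteq> 0"
  shows "zero_set (glue (mult_section mul e v)) = range (coord_point :: 'm::{finite,linorder} \<Rightarrow> _)"
proof -
  have zero_iff: "glue (mult_section mul e v) p = fibre_zero p \<longleftrightarrow> p = coord_point i"
    if "p \<in> affine_open i" for p and i :: 'm
    using glue_eq_fibre_zero_iff[OF cocycle_deletion_transition[OF card]
        compatible_mult_section[OF card] that, of v]
      affine_coords_eq_0_iff[OF card that]
    by (simp add: mult_section_right_mult right_mult_eq_0_iff[OF v])
  show ?thesis
    using zero_iff coord_point_in_affine_open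
    by (auto simp: zero_set_def) (metis affine_open_cover rangeI)
qed

text \<open>
  An injective linear endomorphism of \<open>\<real>\<^sup>d\<close> is invertible and equals its own derivative, so the
  derivative of the local expression is invertible at every point, zero or not.
\<close>

lemma nondegenerate_glue_mult_section:
  assumes card: "CARD('m::{finite,linorder}) = CARD('n) + 1" and v: "v \<noteq> 0"
  shows "nondegenerate_at (glue (mult_section mul e v)) (p :: 'm::{finite,linorder} rproj)"
proof -
  have "right_mult v = (\<lambda>x. matrix (right_mult v) *v x)"
    using linear_right_mult by (simp add: matrix_works fun_eq_iff)
  moreover have "invertible (matrix (right_mult v))"
    using inj_right_mult[OF v] linear_right_mult
    by (metis invertible_left_inverse matrix_left_invertible_injective
        calculation)
  moreover have "(right_mult v has_derivative right_mult v) F" for F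
    using linear_right_mult bounded_linear_imp_has_derivative linear_conv_bounded_linear by blast
  ultimately show ?thesis
    unfolding nondegenerate_at_def local_expr_glue_mult_section[OF card] by metis
qed

end

end

theorem lemma4p1:
  fixes mul :: "'a::real_vector \<Rightarrow> 'a \<Rightarrow> 'a"
    and one :: 'a
    and N :: "'a \<Rightarrow> real"
    and e :: "'n::{finite,linorder} \<Rightarrow> 'a"
    and v :: 'a
  assumes "composition_division_algebra mul one N"
    and "orthonormal_basis N e"
    and "CARD('m::{finite,linorder}) = CARD('n) + 1"
    and "v \<noteq> 0"
  shows
    "(\<forall>i::'m. \<forall>p \<in> affine_open i.
        mult_section mul e v i p = coords e (mul (chart_elem e i p) v)) \<and>
     (\<forall>(i::'m) j. \<forall>p \<in> affine_open i \<inter> affine_open j.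
        mult_section mul e v i p = deletion_transition mul e i j p *v mult_section mul e v j p) \<and>
     (\<exists>!s :: 'm rproj \<Rightarrow> ('m, 'n) bundle_point.
        global_section (deletion_transition mul e) s \<and>
        glues_to (deletion_transition mul e) (mult_section mul e v) s) \<and>
     (\<forall>s :: 'm rproj \<Rightarrow> ('m, 'n) bundle_point.
        global_section (deletion_transition mul e) s \<and>
        glues_to (deletion_transition mul e) (mult_section mul e v) s \<longrightarrow>
        zero_set s = range coord_point \<and> (\<forall>p \<in> zero_set s. nondegenerate_at s p))"
proof -
  interpret composition_division_algebra mul one N by fact
  let ?g = "deletion_transition mul e :: ('m, 'n) transition"
  let ?f = "mult_section mul e v :: 'm \<Rightarrow> 'm rproj \<Rightarrow> (real, 'n) vec"
  note basis = assms(2) and card = assms(3) and v = assms(4)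
  have glues: "glues_to ?g ?f s \<longleftrightarrow> s = glue ?f" for s
    using cocycle_deletion_transition[OF basis card] compatible_mult_section[OF basis card]
    by (rule compatible_family_glues)
  show ?thesis
    unfolding glues
  proof (intro conjI allI impI ballI)
    fix i :: 'm and p
    show "?f i p = coords e (mul (chart_elem e i p) v)" by (rule mult_section_mul[OF basis])
  next
    fix i j :: 'm and p assume "p \<in> affine_open i \<inter> affine_open j"
    then show "?f i p = ?g i j p *v ?f j p"
      using compatible_familyD[OF compatible_mult_section[OF basis card]] by blast
  next
    show "\<exists>!s. global_section ?g s \<and> s = glue ?f"
      using global_section_glue_mult_section[OF basis card] by blast
  next
    fix s assume s: "global_section ?g s \<and> s = glue ?f"
    then show "zero_set s = range coord_point"
      using zero_set_glue_mult_section[OF basis card v] by simp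
    fix p
    show "nondegenerate_at s p"
      using s nondegenerate_glue_mult_section[OF basis card v] by simp
  qed
qed

end
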